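(* Consider the problem $\min_{x\in\mathcal X} f(x)$, $f=\frac1n\sum_{i=1}^n f_i$, where $\mathcal X\subset\mathbb R^d$ is convex and compact with diameter $D$, i.e. $\|x-y\|\le D$ for all $x,y\in\mathcal X$; $f$ is $L$-smooth on $\mathcal X$; and each $f_i$ is $L_i$-smooth on $\mathcal X$ (neither $f$ nor the $f_i$ are assumed convex). Let $\tilde L^2=\frac1n\sum_{i=1}^n L_i^2$ and let $x^*$ be a global (possibly non-unique) minimizer of $f$ on $\mathcal X$. Let $\{x^k\}_{k\ge0}$ be the iterates of the Saga Sarah Frank-Wolfe algorithm (described in the context, with any of the initializations allowed there) with batch size $b$. If $\eta_k=\frac1{\sqrt K}$, where $K$ is the number of iterations, and $\lambda=\frac b{2n}$, then $$\mathbb E\left[\min_{0\le k\le K-1}\operatorname{gap}(x^k)\right]=\mathcal O\left(\frac{f(x^0)-f(x^* )}{\sqrt K}+\frac{LD^2}{\sqrt K}\left[1+\frac{\tilde L\sqrt n}{Lb}\right]\right),$$ where $\operatorname{gap}(y)=\max_{x\in\mathcal X}\langle\nabla f(y),y-x\rangle$.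
   Context: Norms and inner products are Euclidean and $[n]=\{1,\dots,n\}$. The functions $f,f_i:\mathcal X\to\mathbb R$ are differentiable. A function $h$ is $M$-smooth on $\mathcal X$, with constant $M>0$, if $\|\nabla h(x)-\nabla h(y)\|\le M\|x-y\|$ for all $x,y\in\mathcal X$. Saga Sarah Frank-Wolfe algorithm. Parameters: step sizes $\{\eta_k\}_{k\ge0}$, momentum $\lambda$, batch size $b$. Initialization: choose $x^0\in\mathcal X$; $g^0=\nabla f(x^0)$ or $g^0=\nabla f_{i_0}(x^0)$ for an index $i_0\in[n]$; $y_i^0=\nabla f_i(x^0)$ or $y_i^0=0$ for $i\in[n]$. For $k=0,1,\dots,K-1$: (1) compute $s^k=\arg\min_{s\in\mathcal X}\langle g^k,s\rangle$; (2) $x^{k+1}=x^k+\eta_k(s^k-x^k)$; (3) generate a batch $S_k$ of $b$ indices, drawn uniformly and independently at random from $[n]$; (4) $g^{k+1}=\frac1b\sum_{i\in S_k}[\nabla f_i(x^{k+1})-\nabla f_i(x^k)]+(1-\lambda)g^k+\lambda\left(\frac1b\sum_{i\in S_k}[\nabla f_i(x^k)-y_i^k]+\frac1n\sum_{j=1}^n y_j^k\right)$; (5) $y_i^{k+1}=\nabla f_i(x^{k+1})$ if $i\in S_k$, and $y_i^{k+1}=y_i^k$ if $i\notin S_k$. $\mathcal O(\cdot)$ hides an absolute numerical constant.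
   Formalization: The stated bound fails for inexact g^0 or y_i^0 and for b>4n; it is proved with constant 100 for b≤2n: for all K≥1 if g^0=∇f(x^0) and all y_i^0=∇f_i(x^0), otherwise only for K≥K_0, where K_0 may depend on the problem and the initialization. *)

theory Defs
  imports "HOL-Probability.Probability"
begin

text \<open>
  The functions of the problem live on \<open>X\<close> only, so the derivative is taken within \<open>X\<close>.
  If \<open>X\<close> has empty interior, this does not determine the components of the gradient orthogonal to
  the affine hull of \<open>X\<close>; any field with the property below is then admitted as a gradient.
\<close>

definition is_gradient_on :: "('a::euclidean_space \<Rightarrow> real) \<Rightarrow> ('a \<Rightarrow> 'a) \<Rightarrow> 'a set \<Rightarrow> bool" where
  "is_gradient_on h dh X \<longleftrightarrow>
     (\<forall>x\<in>X. (h has_derivative (\<lambda>v. dh x \<bullet> v)) (at x within X))"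

definition smooth_on :: "real \<Rightarrow> ('a::euclidean_space \<Rightarrow> real) \<Rightarrow> ('a \<Rightarrow> 'a) \<Rightarrow> 'a set \<Rightarrow> bool" where
  "smooth_on M h dh X \<longleftrightarrow>
     0 < M \<and> is_gradient_on h dh X \<and>
     (\<forall>x\<in>X. \<forall>y\<in>X. norm (dh x - dh y) \<le> M * norm (x - y))"

text \<open>The supremum is a maximum when \<open>X\<close> is compact and nonempty.\<close>

definition fw_gap :: "'a::euclidean_space set \<Rightarrow> ('a \<Rightarrow> 'a) \<Rightarrow> 'a \<Rightarrow> real" where
  "fw_gap X dF y = (SUP x\<in>X. dF y \<bullet> (y - x))"

text \<open>
  An arbitrary rule for choosing a point of the argmin over \<open>X\<close> of the linear form given by \<open>g\<close>.
  The choice may depend on \<open>g\<close> and on the list of batches drawn so far (not on later ones).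
\<close>

definition lmo_on :: "'a::euclidean_space set \<Rightarrow> (nat list list \<Rightarrow> 'a \<Rightarrow> 'a) \<Rightarrow> bool" where
  "lmo_on X lmo \<longleftrightarrow> (\<forall>hist g. lmo hist g \<in> X \<and> (\<forall>s\<in>X. g \<bullet> lmo hist g \<le> g \<bullet> s))"

text \<open>
  State \<open>(x\<^sup>k, g\<^sup>k, y\<^sup>k)\<close> of the method after \<open>k\<close> steps, for a given realisation \<open>S\<close> of the batches.
  A batch is the list of the \<open>b\<close> indices drawn, so that the sums over it count repeated indices
  with multiplicity; \<open>df i\<close> is the gradient of the \<open>i\<close>-th component.
\<close>

primrec saga_sarah_fw ::
  "nat \<Rightarrow> nat \<Rightarrow> (nat \<Rightarrow> real) \<Rightarrow> real \<Rightarrow> (nat \<Rightarrow> 'a \<Rightarrow> 'a) \<Rightarrow> (nat list list \<Rightarrow> 'a \<Rightarrow> 'a) \<Rightarrow>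
   'a \<Rightarrow> 'a \<Rightarrow> (nat \<Rightarrow> 'a) \<Rightarrow> (nat \<Rightarrow> nat list) \<Rightarrow> nat \<Rightarrow> 'a::euclidean_space \<times> 'a \<times> (nat \<Rightarrow> 'a)" where
  "saga_sarah_fw n b eta lam df lmo x0 g0 y0 S 0 = (x0, g0, y0)"
| "saga_sarah_fw n b eta lam df lmo x0 g0 y0 S (Suc k) =
    (let (x, g, y) = saga_sarah_fw n b eta lam df lmo x0 g0 y0 S k;
         s = lmo (map S [0..<k]) g;
         x' = x + eta k *\<^sub>R (s - x);
         g' = (1 / real b) *\<^sub>R (\<Sum>i\<leftarrow>S k. df i x' - df i x) + (1 - lam) *\<^sub>R g
              + lam *\<^sub>R ((1 / real b) *\<^sub>R (\<Sum>i\<leftarrow>S k. df i x - y i) + (1 / real n) *\<^sub>R (\<Sum>j=1..n. y j));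
         y' = (\<lambda>i. if i \<in> set (S k) then df i x' else y i)
     in (x', g', y'))"

text \<open>
  \<open>K\<close> independent batches, each consisting of \<open>b\<close> independent uniform draws from \<open>{1..n}\<close>.
  For \<open>n \<ge> 1\<close> the support is finite, so every function on it is integrable.
\<close>

definition batches_pmf :: "nat \<Rightarrow> nat \<Rightarrow> nat \<Rightarrow> (nat \<Rightarrow> nat list) pmf" where
  "batches_pmf n b K = Pi_pmf {..<K} [] (\<lambda>_. replicate_pmf b (pmf_of_set {1..n}))"

end

theory Submission
  imports Defs
begin

text \<open>
  Let \<open>G\<close> be the mean of the component gradients and \<open>e\<^sub>k = g\<^sup>k - G(x\<^sup>k)\<close> the error of the gradient
  estimator. Smoothness of \<open>F\<close> and the choice of \<open>s\<^sup>k\<close> give \<open>eta * gap(x\<^sup>k) \<le> F(x\<^sup>k) - F(x\<^sup>k\<^sup>+\<^sup>1) +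
  eta * D * norm e\<^sub>k + L * (eta * D)\<^sup>2\<close> (lemma \<open>descent\<close>). Summing over \<open>k\<close> telescopes, so it remains to
  bound the expected norms of the errors.

  Given the past, the noise added to \<open>(1 - \<lambda>) e\<^sub>k\<close> in one iteration is a mean of \<open>b\<close> independent
  centred vectors, and its second moment is controlled by the distance \<open>eta * D\<close> travelled and by the
  mean squared error of the gradient table (\<open>err_step\<close>). An entry of the table survives with
  probability \<open>(1 - 1/n)\<^sup>b \<le> n / (n + b)\<close>, so the table error contracts by the factor \<open>1 - \<lambda>/3\<close> up to
  \<open>1/\<lambda>\<close> times the mean squared change of the component gradients (\<open>tab_err_step\<close>). A weighted sum of both errors therefore
  contracts by \<open>1 - \<lambda>/6\<close> in expectation (\<open>lyap_step\<close>), and the expected norm of \<open>e\<^sub>k\<close> is at most a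
  geometrically decaying multiple of the initial error plus a constant of order
  \<open>sqrt n * Lt * eta * D / b\<close> (\<open>expectation_norm_err\<close>).

  With \<open>eta = 1 / sqrt K\<close> the constant yields the claimed rate. The initial error contributes only
  \<open>O(1/K)\<close>, which is dominated by the other terms once \<open>K\<close> is large, and is zero for the exact
  initialization. One point needs care: if \<open>X\<close> has empty interior, the given gradient \<open>dF\<close> may differ
  from \<open>G\<close> by vectors orthogonal to all differences of points of \<open>X\<close>. These do not affect the linear
  minimization, and the part of the initial error that they cause is subtracted throughout.
\<close>

section \<open>Expectations over finitely supported distributions\<close>

lemma expectation_bind_finite:
  fixes h :: "'b \<Rightarrow> real"
  assumes "finite (set_pmf p)" "\<And>x. x \<in> set_pmf p \<Longrightarrow> finite (set_pmf (f x))"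
  shows "measure_pmf.expectation (bind_pmf p f) h =
    measure_pmf.expectation p (\<lambda>x. measure_pmf.expectation (f x) h)"
  using assms
  by (subst pmf_expectation_bind[of "set_pmf p"])
     (auto simp: integral_measure_pmf[of "set_pmf p"])

lemma expectation_mono_finite:
  fixes f g :: "'a \<Rightarrow> real"
  assumes "finite (set_pmf p)" "\<And>x. x \<in> set_pmf p \<Longrightarrow> f x \<le> g x"
  shows "measure_pmf.expectation p f \<le> measure_pmf.expectation p g"
  using assms
  by (intro integral_mono_AE integrable_measure_pmf_finite) (auto simp: AE_measure_pmf_iff)

lemma expectation_le_sqrt_second_moment:
  fixes f :: "'a \<Rightarrow> real"
  assumes "finite (set_pmf p)"
  shows "measure_pmf.expectation p f \<le> sqrt (measure_pmf.expectation p (\<lambda>x. (f x)\<^sup>2))"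
proof (rule real_le_rsqrt)
  have "0 \<le> measure_pmf.variance p f"
    by (rule measure_pmf.variance_positive)
  also have "\<dots> = measure_pmf.expectation p (\<lambda>x. (f x)\<^sup>2) - (measure_pmf.expectation p f)\<^sup>2"
    by (intro measure_pmf.variance_eq integrable_measure_pmf_finite assms)
  finally show "(measure_pmf.expectation p f)\<^sup>2 \<le> measure_pmf.expectation p (\<lambda>x. (f x)\<^sup>2)"
    by simp
qed

lemma finite_set_replicate_pmf:
  assumes "finite (set_pmf p)"
  shows "finite (set_pmf (replicate_pmf m p))"
  using finite_lists_length_eq[OF assms, of m]
  by (auto simp: set_replicate_pmf lists_eq_set conj_commute elim!: rev_finite_subset)

lemma finite_set_Pi_pmf:
  assumes "finite I" "\<And>i. i \<in> I \<Longrightarrow> finite (set_pmf (q i))"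
  shows "finite (set_pmf (Pi_pmf I dflt q))"
  using assms by (auto simp: set_Pi_pmf)

text \<open>
  Redrawing one coordinate of a product distribution does not change the expectation. The inner
  expectation is the conditional one given all coordinates other than \<open>i\<close>.
\<close>

lemma expectation_Pi_pmf_resample:
  fixes h :: "('i \<Rightarrow> 'b) \<Rightarrow> real"
  assumes I: "finite I" "i \<in> I" and q: "\<And>i. i \<in> I \<Longrightarrow> finite (set_pmf (q i))"
  shows "measure_pmf.expectation (Pi_pmf I dflt q) h =
    measure_pmf.expectation (Pi_pmf I dflt q)
      (\<lambda>S. measure_pmf.expectation (q i) (\<lambda>B. h (S(i := B))))"
proof -
  define P where "P = Pi_pmf (I - {i}) dflt q"
  have finP: "finite (set_pmf P)"
    unfolding P_def using I q by (intro finite_set_Pi_pmf) auto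
  have ins: "insert i (I - {i}) = I"
    using I by auto
  have "Pi_pmf I dflt q = do {y \<leftarrow> q i; f \<leftarrow> P; return_pmf (f(i := y))}"
    using Pi_pmf_insert'[of "I - {i}" i dflt q] I unfolding P_def ins by simp
  then have eq: "Pi_pmf I dflt q = do {f \<leftarrow> P; y \<leftarrow> q i; return_pmf (f(i := y))}"
    by (simp add: bind_commute_pmf[of P])
  have split: "measure_pmf.expectation (Pi_pmf I dflt q) G =
      measure_pmf.expectation P (\<lambda>f. measure_pmf.expectation (q i) (\<lambda>y. G (f(i := y))))"
    for G :: "('i \<Rightarrow> 'b) \<Rightarrow> real"
    unfolding eq using finP q[OF I(2)]
    by (simp add: expectation_bind_finite)
  show ?thesis
    by (subst (1 2) split) simp
qed

section \<open>Batches of independent uniform indices\<close>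

abbreviation batch_pmf :: "nat \<Rightarrow> nat \<Rightarrow> nat list pmf" where
  "batch_pmf n m \<equiv> replicate_pmf m (pmf_of_set {1..n})"

lemma finite_set_batch_pmf: "1 \<le> n \<Longrightarrow> finite (set_pmf (batch_pmf n m))"
  by (intro finite_set_replicate_pmf) (simp add: set_pmf_of_set)

lemma finite_set_batches_pmf: "1 \<le> n \<Longrightarrow> finite (set_pmf (batches_pmf n b K))"
  unfolding batches_pmf_def by (intro finite_set_Pi_pmf finite_set_batch_pmf) auto

lemma expectation_batch_pmf_Suc:
  fixes h :: "nat list \<Rightarrow> real"
  assumes "1 \<le> n"
  shows "measure_pmf.expectation (batch_pmf n (Suc m)) h =
    (\<Sum>i=1..n. measure_pmf.expectation (batch_pmf n m) (\<lambda>B. h (i # B))) / real n"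
  using assms finite_set_batch_pmf[OF assms, of m]
  by (simp add: expectation_bind_finite integral_pmf_of_set)

text \<open>
  The terms are independent and centred, so all cross terms vanish, including those with the
  deterministic vector \<open>a\<close>; keeping \<open>a\<close> general makes the induction on \<open>m\<close> go through.
\<close>

lemma batch_second_moment:
  fixes z :: "nat \<Rightarrow> 'a::euclidean_space"
  assumes n: "1 \<le> n" and z: "(\<Sum>i=1..n. z i) = 0"
  shows "measure_pmf.expectation (batch_pmf n m) (\<lambda>B. (norm (a + (\<Sum>i\<leftarrow>B. z i)))\<^sup>2) =
    (norm a)\<^sup>2 + real m * ((\<Sum>i=1..n. (norm (z i))\<^sup>2) / real n)"
proof (induction m arbitrary: a)
  case 0
  show ?case by simp
next
  case (Suc m)
  define q where "q = (\<Sum>i=1..n. (norm (z i))\<^sup>2) / real n"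
  have "measure_pmf.expectation (batch_pmf n (Suc m)) (\<lambda>B. (norm (a + (\<Sum>i\<leftarrow>B. z i)))\<^sup>2) =
      (\<Sum>i=1..n. measure_pmf.expectation (batch_pmf n m)
        (\<lambda>B. (norm ((a + z i) + (\<Sum>j\<leftarrow>B. z j)))\<^sup>2)) / real n"
    by (subst expectation_batch_pmf_Suc[OF n]) (simp add: add.assoc)
  also have "\<dots> = (\<Sum>i=1..n. (norm (a + z i))\<^sup>2 + real m * q) / real n"
    by (simp only: Suc.IH q_def)
  also have "(\<Sum>i=1..n. (norm (a + z i))\<^sup>2 + real m * q) =
      (\<Sum>i=1..n. (norm a)\<^sup>2 + real m * q + 2 * (a \<bullet> z i) + (norm (z i))\<^sup>2)"
    by (simp add: power2_norm_eq_inner inner_add inner_commute algebra_simps)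
  also have "\<dots> = real n * ((norm a)\<^sup>2 + real m * q) + 2 * (a \<bullet> (\<Sum>i=1..n. z i))
      + (\<Sum>i=1..n. (norm (z i))\<^sup>2)"
    by (simp add: sum.distrib sum_distrib_left inner_sum_right)
  also have "\<dots> / real n = (norm a)\<^sup>2 + real (Suc m) * q"
    using n unfolding z q_def by (simp add: field_simps)
  finally show ?case
    unfolding q_def .
qed

lemma batch_miss_probability:
  assumes n: "1 \<le> n" and i: "i \<in> {1..n}"
  shows "measure_pmf.expectation (batch_pmf n m) (\<lambda>B. if i \<in> set B then 0 else 1) =
    (1 - 1 / real n) ^ m"
proof (induction m)
  case 0
  show ?case by simp
next
  case (Suc m)
  have "measure_pmf.expectation (batch_pmf n (Suc m)) (\<lambda>B. if i \<in> set B then 0 else 1) =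
    (\<Sum>j=1..n. measure_pmf.expectation (batch_pmf n m)
       (\<lambda>B. if i \<in> set (j # B) then 0 else 1)) / real n"
    by (subst expectation_batch_pmf_Suc[OF n]) (rule refl)
  also have "(\<Sum>j=1..n. measure_pmf.expectation (batch_pmf n m)
       (\<lambda>B. if i \<in> set (j # B) then 0 else 1)) =
     (\<Sum>j=1..n. (1 - 1 / real n) ^ m - (if j = i then (1 - 1 / real n) ^ m else 0))"
    using Suc.IH by (intro sum.cong) auto
  also have "\<dots> / real n = (1 - 1 / real n) ^ Suc m"
    using n i by (simp add: sum_subtractf diff_divide_distrib left_diff_distrib)
  finally show ?case .
qed

text \<open>
  From \<open>1 - 1/n \<le> 1 / (1 + 1/n)\<close> and Bernoulli's inequality for \<open>(1 + 1/n)\<^sup>m\<close>.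
\<close>

lemma batch_miss_probability_le:
  assumes "1 \<le> n"
  shows "(1 - 1 / real n) ^ m \<le> real n / real (n + m)"
proof -
  have "(1 - 1 / real n) ^ m * (1 + 1 / real n) ^ m = (1 - (1 / real n)\<^sup>2) ^ m"
    by (simp add: power_mult_distrib[symmetric] algebra_simps power2_eq_square)
  also have "\<dots> \<le> 1"
    using assms by (intro power_le_one) (auto simp: power_le_one)
  finally have le1: "(1 - 1 / real n) ^ m * (1 + 1 / real n) ^ m \<le> 1" .
  have "(1 - 1 / real n) ^ m * (1 + real m * (1 / real n)) \<le>
      (1 - 1 / real n) ^ m * (1 + 1 / real n) ^ m"
    using assms
    by (intro mult_left_mono Bernoulli_inequality) (auto intro: order_trans[of _ 0])
  with le1 have "(1 - 1 / real n) ^ m * (1 + real m * (1 / real n)) \<le> 1"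
    by linarith
  then show ?thesis
    using assms by (simp add: field_simps)
qed

text \<open>
  The variance is at most the second moment.
\<close>

lemma sum_norm_centered_le:
  fixes w :: "nat \<Rightarrow> 'a::euclidean_space"
  assumes n: "1 \<le> n"
  defines "c \<equiv> (1 / real n) *\<^sub>R (\<Sum>i=1..n. w i)"
  shows "(\<Sum>i=1..n. (norm (w i - c))\<^sup>2) \<le> (\<Sum>i=1..n. (norm (w i))\<^sup>2)"
proof -
  have "(\<Sum>i=1..n. (norm (w i - c))\<^sup>2) =
      (\<Sum>i=1..n. (norm (w i))\<^sup>2 - 2 * (w i \<bullet> c) + (norm c)\<^sup>2)"
    by (simp add: power2_norm_eq_inner inner_diff inner_commute algebra_simps)
  also have "\<dots> = (\<Sum>i=1..n. (norm (w i))\<^sup>2) - 2 * ((\<Sum>i=1..n. w i) \<bullet> c) + real n * (norm c)\<^sup>2"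
    by (simp add: sum.distrib sum_subtractf sum_distrib_left inner_sum_left)
  also have "(\<Sum>i=1..n. w i) = real n *\<^sub>R c"
    using n by (simp add: c_def)
  finally show ?thesis
    by (simp add: power2_norm_eq_inner)
qed

lemma norm_add_sq_young:
  assumes "0 < t"
  shows "(norm (u + v :: 'a::euclidean_space))\<^sup>2 \<le> (1 + t) * (norm u)\<^sup>2 + (1 + 1 / t) * (norm v)\<^sup>2"
proof -
  have "0 \<le> (norm (t *\<^sub>R u - v))\<^sup>2 / t"
    using assms by simp
  also have "\<dots> = t * (norm u)\<^sup>2 - 2 * (u \<bullet> v) + (norm v)\<^sup>2 / t"
    using assms
    by (simp add: power2_norm_eq_inner inner_diff inner_commute field_simps)
  finally show ?thesis
    by (simp add: power2_norm_eq_inner inner_add inner_commute algebra_simps)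
qed

section \<open>Gradients on a convex set\<close>

lemma gradient_along_segment:
  assumes grad: "is_gradient_on h dh X" and X: "convex X" "x \<in> X" "z \<in> X" and t: "t \<in> {0..1}"
  shows "((\<lambda>t. h (x + t *\<^sub>R (z - x))) has_vector_derivative (dh (x + t *\<^sub>R (z - x)) \<bullet> (z - x)))
    (at t within {0..1})"
proof -
  let ?c = "\<lambda>t. x + t *\<^sub>R (z - x)"
  have c: "?c s \<in> X" if "s \<in> {0..1}" for s
    using convexD_alt[of X x z s] that X by (simp add: algebra_simps)
  have h: "(h has_derivative (\<lambda>v. dh (?c t) \<bullet> v)) (at (?c t) within ?c ` {0..1})"
    using grad c t unfolding is_gradient_on_def by (blast intro: has_derivative_subset)
  have "(?c has_derivative (\<lambda>s. s *\<^sub>R (z - x))) (at t within {0..1})"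
    by (auto intro!: derivative_eq_intros)
  from has_derivative_in_compose[OF this h] show ?thesis
    by (simp add: has_vector_derivative_def)
qed

text \<open>
  A gradient within \<open>X\<close> need not be unique when \<open>X\<close> has empty interior, but its
  inner products with directions pointing into \<open>X\<close> are.
\<close>

lemma gradients_agree_on_directions:
  assumes "is_gradient_on h a X" "is_gradient_on h c X" "convex X" "x \<in> X" "z \<in> X"
  shows "a x \<bullet> (z - x) = c x \<bullet> (z - x)"
  using gradient_along_segment[OF assms(1,3-5), of 0] gradient_along_segment[OF assms(2,3-5), of 0]
    vector_derivative_unique_within_closed_interval[of 0 1 0 "\<lambda>t. h (x + t *\<^sub>R (z - x))"]
  by auto

text \<open>
  The mean value theorem gives the constant \<open>M\<close> in place of the sharp \<open>M / 2\<close>, which only affects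
  numerical constants below.
\<close>

lemma smooth_on_upper_bound:
  assumes sm: "smooth_on M h dh X" and X: "convex X" "x \<in> X" "z \<in> X"
  shows "h z \<le> h x + dh x \<bullet> (z - x) + M * (norm (z - x))\<^sup>2"
proof -
  let ?c = "\<lambda>t. x + t *\<^sub>R (z - x)"
  have grad: "is_gradient_on h dh X" and M: "0 < M"
    and lip: "\<And>x y. x \<in> X \<Longrightarrow> y \<in> X \<Longrightarrow> norm (dh x - dh y) \<le> M * norm (x - y)"
    using sm by (auto simp: smooth_on_def)
  obtain t where t: "t \<in> {0..1}" and eq: "h (?c 1) - h (?c 0) = (1 - 0) * (dh (?c t) \<bullet> (z - x))"
    using mvt_very_simple[of 0 1 "\<lambda>t. h (?c t)" "\<lambda>t s. s * (dh (?c t) \<bullet> (z - x))"]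
      gradient_along_segment[OF grad X] by (auto simp: has_vector_derivative_def)
  have ct: "?c t \<in> X"
    using convexD_alt[of X x z t] t X by (simp add: algebra_simps)
  have "(dh (?c t) - dh x) \<bullet> (z - x) \<le> norm (dh (?c t) - dh x) * norm (z - x)"
    by (rule norm_cauchy_schwarz)
  also have "\<dots> \<le> (M * norm (?c t - x)) * norm (z - x)"
    using lip[OF ct X(2)] by (rule mult_right_mono) simp
  also have "\<dots> = \<bar>t\<bar> * (M * (norm (z - x))\<^sup>2)"
    by (simp add: power2_eq_square)
  also have "\<dots> \<le> 1 * (M * (norm (z - x))\<^sup>2)"
    using t M by (intro mult_right_mono) auto
  finally show ?thesis
    using eq by (simp add: inner_diff_left)
qed

lemma is_gradient_on_mean:
  assumes F: "\<And>x. x \<in> X \<Longrightarrow> F x = (1 / real n) * (\<Sum>i=1..n. f i x)"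
    and grad: "\<And>i. i \<in> {1..n} \<Longrightarrow> is_gradient_on (f i) (df i) X"
  shows "is_gradient_on F (\<lambda>x. (1 / real n) *\<^sub>R (\<Sum>i=1..n. df i x)) X"
  unfolding is_gradient_on_def
proof
  fix x assume x: "x \<in> X"
  have "((\<lambda>x. (1 / real n) * (\<Sum>i=1..n. f i x)) has_derivative
      (\<lambda>v. (1 / real n) * (\<Sum>i=1..n. df i x \<bullet> v))) (at x within X)"
    using grad x unfolding is_gradient_on_def
    by (intro has_derivative_mult_right has_derivative_sum) auto
  then have "(F has_derivative (\<lambda>v. (1 / real n) * (\<Sum>i=1..n. df i x \<bullet> v))) (at x within X)"
    using F x by (intro has_derivative_transform[OF x F]) auto
  also have "(\<lambda>v. (1 / real n) * (\<Sum>i=1..n. df i x \<bullet> v)) =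
      (\<bullet>) ((1 / real n) *\<^sub>R (\<Sum>i=1..n. df i x))"
    by (simp add: fun_eq_iff inner_sum_left)
  finally show "(F has_derivative (\<bullet>) ((1 / real n) *\<^sub>R (\<Sum>i=1..n. df i x))) (at x within X)" .
qed

section \<open>One iteration of the method\<close>

text \<open>
  The method with a constant step size \<open>eta\<close> and an arbitrary initial estimator and gradient table.
  The vector \<open>r\<close>, orthogonal to all directions of \<open>X\<close>, stands for the part of the initial error
  \<open>g\<^sup>0 - (1/n) \<Sum>\<^sub>i \<nabla>f\<^sub>i(x\<^sup>0)\<close> to be disregarded: it does not influence linear
  minimization over \<open>X\<close>. It is needed because \<open>dF\<close> and the mean of the \<open>df i\<close> may differ by such a vector.
\<close>

locale saga_sarah =
  fixes X :: "'a::euclidean_space set"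
    and f :: "nat \<Rightarrow> 'a \<Rightarrow> real" and df :: "nat \<Rightarrow> 'a \<Rightarrow> 'a"
    and F :: "'a \<Rightarrow> real" and dF :: "'a \<Rightarrow> 'a"
    and n b :: nat and D L Lt :: real and Ls :: "nat \<Rightarrow> real"
    and lmo :: "nat list list \<Rightarrow> 'a \<Rightarrow> 'a"
    and x0 g0 :: 'a and y0 :: "nat \<Rightarrow> 'a"
    and eta :: real and r :: 'a
  assumes n: "1 \<le> n" and b: "1 \<le> b" "b \<le> 2 * n"
    and X: "convex X" "\<And>x y. x \<in> X \<Longrightarrow> y \<in> X \<Longrightarrow> norm (x - y) \<le> D"
    and F: "\<And>x. x \<in> X \<Longrightarrow> F x = (1 / real n) * (\<Sum>i=1..n. f i x)"
    and smooth_F: "smooth_on L F dF X"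
    and smooth_f: "\<And>i. i \<in> {1..n} \<Longrightarrow> smooth_on (Ls i) (f i) (df i) X"
    and Lt: "0 \<le> Lt" "Lt\<^sup>2 = (1 / real n) * (\<Sum>i=1..n. (Ls i)\<^sup>2)"
    and lmo: "lmo_on X lmo"
    and x0: "x0 \<in> X"
    and eta: "0 < eta" "eta \<le> 1"
    and r_orthogonal: "\<And>x y. x \<in> X \<Longrightarrow> y \<in> X \<Longrightarrow> r \<bullet> (x - y) = 0"
begin

text \<open>
  The momentum parameter \<open>\<lambda>\<close>.
\<close>

definition lam :: real where
  "lam = real b / (2 * real n)"

text \<open>
  The mean of the component gradients, which is one of the gradients of \<open>F\<close> on \<open>X\<close>.
\<close>

definition mean_grad :: "'a \<Rightarrow> 'a" where
  "mean_grad x = (1 / real n) *\<^sub>R (\<Sum>i=1..n. df i x)"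

text \<open>
  The state \<open>(x\<^sup>k, g\<^sup>k, y\<^sup>k)\<close>; its components are the iterate, the gradient estimator and the
  gradient table.
\<close>

definition state :: "(nat \<Rightarrow> nat list) \<Rightarrow> nat \<Rightarrow> 'a \<times> 'a \<times> (nat \<Rightarrow> 'a)" where
  "state S k = saga_sarah_fw n b (\<lambda>_. eta) lam df lmo x0 g0 y0 S k"

definition it :: "(nat \<Rightarrow> nat list) \<Rightarrow> nat \<Rightarrow> 'a" where
  "it S k = fst (state S k)"

definition est :: "(nat \<Rightarrow> nat list) \<Rightarrow> nat \<Rightarrow> 'a" where
  "est S k = fst (snd (state S k))"

definition tab :: "(nat \<Rightarrow> nat list) \<Rightarrow> nat \<Rightarrow> nat \<Rightarrow> 'a" where
  "tab S k = snd (snd (state S k))"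

text \<open>
  The estimation error. Each iteration multiplies the component \<open>r\<close> of the initial error by
  \<open>1 - \<lambda>\<close>, which gives the factor in front of \<open>r\<close>.
\<close>

definition err :: "(nat \<Rightarrow> nat list) \<Rightarrow> nat \<Rightarrow> 'a" where
  "err S k = est S k - mean_grad (it S k) - (1 - lam) ^ k *\<^sub>R r"

text \<open>
  The mean squared error of the gradient table.
\<close>

definition tab_err :: "(nat \<Rightarrow> nat list) \<Rightarrow> nat \<Rightarrow> real" where
  "tab_err S k = (1 / real n) * (\<Sum>i=1..n. (norm (df i (it S k) - tab S k i))\<^sup>2)"

text \<open>
  A bound on the mean squared change of the component gradients in one iteration.
\<close>

definition move :: real where
  "move = Lt\<^sup>2 * (eta * D)\<^sup>2"

lemma lam: "0 < lam" "lam \<le> 1"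
  using n b by (auto simp: lam_def)

lemma it_Suc: "it S (Suc k) = it S k + eta *\<^sub>R (lmo (map S [0..<k]) (est S k) - it S k)"
  by (simp add: it_def est_def state_def Let_def split_beta)

lemma est_Suc: "est S (Suc k) =
    (1 / real b) *\<^sub>R (\<Sum>i\<leftarrow>S k. df i (it S (Suc k)) - df i (it S k)) + (1 - lam) *\<^sub>R est S k
    + lam *\<^sub>R ((1 / real b) *\<^sub>R (\<Sum>i\<leftarrow>S k. df i (it S k) - tab S k i)
               + (1 / real n) *\<^sub>R (\<Sum>j=1..n. tab S k j))"
  by (simp add: it_def est_def tab_def state_def Let_def split_beta)

lemma tab_Suc: "tab S (Suc k) i =
    (if i \<in> set (S k) then df i (it S (Suc k)) else tab S k i)"
  by (simp add: it_def est_def tab_def state_def Let_def split_beta)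

lemma state_upd: "k \<le> j \<Longrightarrow> state (S(j := B)) k = state S k"
proof (induction k)
  case 0
  show ?case by (simp add: state_def)
next
  case (Suc k)
  then have "state (S(j := B)) k = state S k"
    by (simp del: fun_upd_apply)
  moreover from Suc.prems have "map (S(j := B)) [0..<k] = map S [0..<k]" "(S(j := B)) k = S k"
    by auto
  ultimately show ?case
    unfolding state_def saga_sarah_fw.simps by (simp only:)
qed

lemma it_upd: "k \<le> j \<Longrightarrow> it (S(j := B)) k = it S k"
  and est_upd: "k \<le> j \<Longrightarrow> est (S(j := B)) k = est S k"
  and tab_upd: "k \<le> j \<Longrightarrow> tab (S(j := B)) k = tab S k"
  by (simp_all add: it_def est_def tab_def state_upd)

text \<open>
  The next iterate is determined before the batch of the current iteration is drawn.
\<close>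

lemma it_Suc_upd: "it (S(k := B)) (Suc k) = it S (Suc k)"
proof -
  have "map (S(k := B)) [0..<k] = map S [0..<k]"
    by auto
  then show ?thesis
    by (simp only: it_Suc it_upd est_upd order_refl)
qed

lemma it_in: "it S k \<in> X"
proof (induction k)
  case 0
  show ?case using x0 by (simp add: it_def state_def)
next
  case (Suc k)
  have "lmo (map S [0..<k]) (est S k) \<in> X"
    using lmo by (simp add: lmo_on_def)
  then show ?case
    using convexD_alt[of X "it S k" "lmo (map S [0..<k]) (est S k)" eta] X(1) Suc eta
    by (simp add: it_Suc algebra_simps)
qed

lemma step_length: "norm (it S (Suc k) - it S k) \<le> eta * D"
proof -
  have "lmo (map S [0..<k]) (est S k) \<in> X"
    using lmo by (simp add: lmo_on_def)
  then show ?thesis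
    using X(2)[OF _ it_in] eta by (simp add: it_Suc)
qed

lemma D_nonneg: "0 \<le> D"
  using X(2)[OF x0 x0] by simp

lemma mean_gradient_change:
  "(1 / real n) * (\<Sum>i=1..n. (norm (df i (it S (Suc k)) - df i (it S k)))\<^sup>2) \<le> move"
proof -
  have "(norm (df i (it S (Suc k)) - df i (it S k)))\<^sup>2 \<le> (Ls i)\<^sup>2 * (eta * D)\<^sup>2" if "i \<in> {1..n}" for i
  proof -
    have "norm (df i (it S (Suc k)) - df i (it S k)) \<le> Ls i * norm (it S (Suc k) - it S k)"
      and "0 < Ls i"
      using smooth_f[OF that] it_in by (auto simp: smooth_on_def)
    with mult_left_mono[OF step_length, of "Ls i" S k]
    have "norm (df i (it S (Suc k)) - df i (it S k)) \<le> Ls i * (eta * D)"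
      by linarith
    then show ?thesis
      unfolding power_mult_distrib[symmetric] by (rule power_mono) simp
  qed
  then have "(\<Sum>i=1..n. (norm (df i (it S (Suc k)) - df i (it S k)))\<^sup>2) \<le>
      (\<Sum>i=1..n. (Ls i)\<^sup>2 * (eta * D)\<^sup>2)"
    by (rule sum_mono)
  then have "(1 / real n) * (\<Sum>i=1..n. (norm (df i (it S (Suc k)) - df i (it S k)))\<^sup>2) \<le>
      (1 / real n) * (\<Sum>i=1..n. (Ls i)\<^sup>2 * (eta * D)\<^sup>2)"
    by (rule mult_left_mono) simp
  then show ?thesis
    by (simp add: move_def Lt(2) sum_distrib_right)
qed

text \<open>
  The new error is \<open>1 - \<lambda>\<close> times the old one plus a batch mean of the centred vectors \<open>w i - c\<close>,
  which has expectation zero given the past.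
\<close>

lemma err_upd:
  fixes S k
  defines "w \<equiv> \<lambda>i. (df i (it S (Suc k)) - df i (it S k)) + lam *\<^sub>R (df i (it S k) - tab S k i)"
  defines "c \<equiv> (1 / real n) *\<^sub>R (\<Sum>i=1..n. w i)"
  assumes B: "length B = b"
  shows "err (S(k := B)) (Suc k) = (1 - lam) *\<^sub>R err S k + (\<Sum>i\<leftarrow>B. (1 / real b) *\<^sub>R (w i - c))"
proof -
  have split: "(1 / real b) *\<^sub>R (\<Sum>i\<leftarrow>B. u i) + lam *\<^sub>R ((1 / real b) *\<^sub>R (\<Sum>i\<leftarrow>B. v i)) =
      (\<Sum>i\<leftarrow>B. (1 / real b) *\<^sub>R (u i + lam *\<^sub>R v i - c)) + (real (length B) / real b) *\<^sub>R c"
    for B :: "nat list" and u v :: "nat \<Rightarrow> 'a"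
    by (induction B) (simp_all add: algebra_simps add_divide_distrib)
  have c: "c = mean_grad (it S (Suc k)) - mean_grad (it S k)
      + lam *\<^sub>R (mean_grad (it S k) - (1 / real n) *\<^sub>R (\<Sum>j=1..n. tab S k j))"
    unfolding c_def w_def mean_grad_def
    by (simp add: sum.distrib sum_subtractf scaleR_sum_right[symmetric] algebra_simps)
  have "est (S(k := B)) (Suc k) =
      ((1 / real b) *\<^sub>R (\<Sum>i\<leftarrow>B. df i (it S (Suc k)) - df i (it S k)) +
       lam *\<^sub>R ((1 / real b) *\<^sub>R (\<Sum>i\<leftarrow>B. df i (it S k) - tab S k i)))
      + (1 - lam) *\<^sub>R est S k + lam *\<^sub>R ((1 / real n) *\<^sub>R (\<Sum>j=1..n. tab S k j))"
    by (simp add: est_Suc it_Suc_upd it_upd est_upd tab_upd scaleR_add_right)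
  also have "\<dots> = ((\<Sum>i\<leftarrow>B. (1 / real b) *\<^sub>R (w i - c)) + c)
      + (1 - lam) *\<^sub>R est S k + lam *\<^sub>R ((1 / real n) *\<^sub>R (\<Sum>j=1..n. tab S k j))"
    using B b(1) unfolding split w_def by simp
  finally have "est (S(k := B)) (Suc k) = (\<Sum>i\<leftarrow>B. (1 / real b) *\<^sub>R (w i - c))
      + mean_grad (it S (Suc k)) + (1 - lam) *\<^sub>R (est S k - mean_grad (it S k))"
    unfolding c by (simp add: algebra_simps)
  then show ?thesis
    unfolding err_def it_Suc_upd by (simp add: algebra_simps)
qed

lemma batch_length: "B \<in> set_pmf (batch_pmf n b) \<Longrightarrow> length B = b"
  by (simp add: set_replicate_pmf)

lemma err_step:
  "measure_pmf.expectation (batch_pmf n b) (\<lambda>B. (norm (err (S(k := B)) (Suc k)))\<^sup>2) \<le>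
    (1 - lam) * (norm (err S k))\<^sup>2 + 2 / real b * move + lam / real n * tab_err S k"
proof -
  define w where
    "w i = (df i (it S (Suc k)) - df i (it S k)) + lam *\<^sub>R (df i (it S k) - tab S k i)" for i
  define c where "c = (1 / real n) *\<^sub>R (\<Sum>i=1..n. w i)"
  define z where "z i = (1 / real b) *\<^sub>R (w i - c)" for i
  have z0: "(\<Sum>i=1..n. z i) = 0"
    using n by (simp add: z_def scaleR_sum_right[symmetric] sum_subtractf c_def sum_constant_scaleR)
  have "measure_pmf.expectation (batch_pmf n b) (\<lambda>B. (norm (err (S(k := B)) (Suc k)))\<^sup>2) \<le>
      measure_pmf.expectation (batch_pmf n b)
        (\<lambda>B. (norm ((1 - lam) *\<^sub>R err S k + (\<Sum>i\<leftarrow>B. z i)))\<^sup>2)"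
    by (rule expectation_mono_finite[OF finite_set_batch_pmf[OF n]])
       (simp add: err_upd batch_length z_def w_def c_def)
  also have "\<dots> = (norm ((1 - lam) *\<^sub>R err S k))\<^sup>2
      + real b * ((\<Sum>i=1..n. (norm (z i))\<^sup>2) / real n)"
    by (rule batch_second_moment[OF n z0])
  also have "(\<Sum>i=1..n. (norm (z i))\<^sup>2) = (\<Sum>i=1..n. (norm (w i - c))\<^sup>2) / (real b)\<^sup>2"
    by (simp add: z_def power_divide sum_divide_distrib)
  also have "real b * ((\<Sum>i=1..n. (norm (w i - c))\<^sup>2) / (real b)\<^sup>2 / real n) =
      (1 / (real b * real n)) * (\<Sum>i=1..n. (norm (w i - c))\<^sup>2)"
    using b(1) by (simp add: power2_eq_square)
  also have "\<dots> \<le> (1 / (real b * real n)) * (2 * (\<Sum>i=1..n. (norm (df i (it S (Suc k)) - df i (it S k)))\<^sup>2)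
      + 2 * lam\<^sup>2 * (\<Sum>i=1..n. (norm (df i (it S k) - tab S k i))\<^sup>2))"
  proof (rule mult_left_mono)
    have "(\<Sum>i=1..n. (norm (w i - c))\<^sup>2) \<le> (\<Sum>i=1..n. (norm (w i))\<^sup>2)"
      unfolding c_def by (rule sum_norm_centered_le[OF n])
    also have "\<dots> \<le> (\<Sum>i=1..n. 2 * (norm (df i (it S (Suc k)) - df i (it S k)))\<^sup>2
        + 2 * lam\<^sup>2 * (norm (df i (it S k) - tab S k i))\<^sup>2)"
    proof (rule sum_mono)
      fix i
      show "(norm (w i))\<^sup>2 \<le> 2 * (norm (df i (it S (Suc k)) - df i (it S k)))\<^sup>2
          + 2 * lam\<^sup>2 * (norm (df i (it S k) - tab S k i))\<^sup>2"
        using norm_add_sq_young[of 1 "df i (it S (Suc k)) - df i (it S k)"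
            "lam *\<^sub>R (df i (it S k) - tab S k i)"]
        by (simp add: w_def power_mult_distrib)
    qed
    finally show "(\<Sum>i=1..n. (norm (w i - c))\<^sup>2) \<le>
        2 * (\<Sum>i=1..n. (norm (df i (it S (Suc k)) - df i (it S k)))\<^sup>2)
        + 2 * lam\<^sup>2 * (\<Sum>i=1..n. (norm (df i (it S k) - tab S k i))\<^sup>2)"
      by (simp only: sum.distrib sum_distrib_left)
  qed simp
  also have "\<dots> = 2 / real b * ((1 / real n) * (\<Sum>i=1..n. (norm (df i (it S (Suc k)) - df i (it S k)))\<^sup>2))
      + lam / real n * tab_err S k"
    using n b(1) by (simp add: tab_err_def lam_def field_simps power2_eq_square)
  also have "2 / real b * ((1 / real n) * (\<Sum>i=1..n. (norm (df i (it S (Suc k)) - df i (it S k)))\<^sup>2))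
      \<le> 2 / real b * move"
    by (rule mult_left_mono[OF mean_gradient_change]) simp
  also have "(norm ((1 - lam) *\<^sub>R err S k))\<^sup>2 \<le> (1 - lam) * (norm (err S k))\<^sup>2"
  proof -
    have "(1 - lam)\<^sup>2 \<le> 1 - lam"
      using lam mult_left_mono[of "1 - lam" 1 "1 - lam"] by (simp add: power2_eq_square)
    then have "(1 - lam)\<^sup>2 * (norm (err S k))\<^sup>2 \<le> (1 - lam) * (norm (err S k))\<^sup>2"
      by (rule mult_right_mono) simp
    then show ?thesis
      by (simp add: power_mult_distrib)
  qed
  finally show ?thesis
    by (simp only: add.assoc)
qed

lemma tab_err_nonneg: "0 \<le> tab_err S k"
  by (simp add: tab_err_def sum_nonneg)

lemma move_nonneg: "0 \<le> move"
  by (simp add: move_def)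

text \<open>
  A table entry stays wrong only if its index is missed by the batch; Young's inequality with
  parameter \<open>\<lambda>\<close> balances the inherited error against the change of the gradients.
\<close>

lemma tab_err_step:
  "measure_pmf.expectation (batch_pmf n b) (\<lambda>B. tab_err (S(k := B)) (Suc k)) \<le>
    (1 - lam / 3) * tab_err S k + move / lam"
proof -
  \<comment> \<open>\<open>q\<close> is the probability that an entry is not refreshed, \<open>ch\<close> the mean squared gradient change\<close>
  define c where "c i = (norm (df i (it S (Suc k)) - tab S k i))\<^sup>2" for i
  define q where "q = (1 - 1 / real n) ^ b"
  define ch where "ch = (1 / real n) * (\<Sum>i=1..n. (norm (df i (it S (Suc k)) - df i (it S k)))\<^sup>2)"
  have q: "0 \<le> q" "q \<le> real n / real (n + b)"
    using n batch_miss_probability_le[OF n] by (auto simp: q_def)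
  have "tab_err (S(k := B)) (Suc k) =
      (1 / real n) * (\<Sum>i=1..n. (if i \<in> set B then 0 else 1) * c i)" for B
    unfolding tab_err_def
    by (intro arg_cong[where f = "(*) (1 / real n)"] sum.cong)
       (auto simp: c_def tab_Suc it_Suc_upd tab_upd)
  then have "measure_pmf.expectation (batch_pmf n b) (\<lambda>B. tab_err (S(k := B)) (Suc k)) =
      measure_pmf.expectation (batch_pmf n b)
        (\<lambda>B. (1 / real n) * (\<Sum>i=1..n. (if i \<in> set B then 0 else 1) * c i))"
    by (simp only:)
  also have "\<dots> = (1 / real n) * (\<Sum>i=1..n.
      measure_pmf.expectation (batch_pmf n b) (\<lambda>B. if i \<in> set B then 0 else 1) * c i)"
    by (simp add: integrable_measure_pmf_finite[OF finite_set_batch_pmf[OF n]]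
        del: One_nat_def)
  also have "\<dots> = (1 / real n) * (\<Sum>i=1..n. q * c i)"
    unfolding q_def by (simp only: batch_miss_probability[OF n] cong: sum.cong)
  also have "\<dots> \<le> (1 / real n) * (\<Sum>i=1..n. q * ((1 + lam) * (norm (df i (it S k) - tab S k i))\<^sup>2
      + (1 + 1 / lam) * (norm (df i (it S (Suc k)) - df i (it S k)))\<^sup>2))"
  proof (intro mult_left_mono sum_mono)
    fix i
    show "c i \<le> (1 + lam) * (norm (df i (it S k) - tab S k i))\<^sup>2
        + (1 + 1 / lam) * (norm (df i (it S (Suc k)) - df i (it S k)))\<^sup>2"
      using norm_add_sq_young[OF lam(1), of "df i (it S k) - tab S k i"
          "df i (it S (Suc k)) - df i (it S k)"]
      by (simp add: c_def)
  qed (use q in auto)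
  also have "\<dots> = (q * (1 + lam)) * tab_err S k + (q * (1 + 1 / lam)) * ch"
  proof -
    have "(\<Sum>i=1..n. q * (\<alpha> * u i + \<beta> * v i)) = (q * \<alpha>) * (\<Sum>i=1..n. u i) + (q * \<beta>) * (\<Sum>i=1..n. v i)"
      for \<alpha> \<beta> and u v :: "nat \<Rightarrow> real"
      by (simp add: sum.distrib sum_distrib_left algebra_simps)
    then show ?thesis
      by (simp add: tab_err_def ch_def add_divide_distrib)
  qed
  also have "\<dots> \<le> (1 - lam / 3) * tab_err S k + (1 / lam) * move"
  proof (intro add_mono mult_mono)
    have one_plus: "1 + lam = ((real n + real b) - real b / 2) / real n"
      "1 + 1 / lam = (real b + 2 * real n) / real b"
      using n b by (simp_all add: lam_def field_simps)
    have "q * (1 + lam) \<le> real n / real (n + b) * (1 + lam)"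
      using q lam by (intro mult_right_mono) auto
    also have "\<dots> = ((real n + real b) - real b / 2) / (real n + real b)"
      using n unfolding one_plus by simp
    also have "\<dots> = 1 - (real b / 2) / (real n + real b)"
      using n by (subst diff_divide_distrib) simp
    also have "\<dots> \<le> 1 - (real b / 2) / (3 * real n)"
      using n b by (intro diff_left_mono divide_left_mono) auto
    finally show "q * (1 + lam) \<le> 1 - lam / 3"
      by (simp add: lam_def)
    have "q * (1 + 1 / lam) \<le> real n / real (n + b) * (1 + 1 / lam)"
      using q lam by (intro mult_right_mono) auto
    also have "\<dots> = (real n * (real b + 2 * real n)) / ((real n + real b) * real b)"
      unfolding one_plus by simp
    also have "\<dots> \<le> (real n * (2 * (real n + real b))) / ((real n + real b) * real b)"
      by (intro divide_right_mono mult_left_mono) auto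
    also have "\<dots> = 1 / lam"
    proof -
      have "real n + real b \<noteq> 0"
        using n by linarith
      then show ?thesis
        by (simp add: lam_def del: distrib_left_numeral)
    qed
    finally show "q * (1 + 1 / lam) \<le> 1 / lam" .
    show "ch \<le> move"
      unfolding ch_def by (rule mean_gradient_change)
  qed (use lam in \<open>auto simp: ch_def tab_err_nonneg sum_nonneg\<close>)
  finally show ?thesis by simp
qed

section \<open>Decay of the estimation error\<close>

text \<open>
  The Lyapunov function. The weight \<open>6/n\<close> lets the contraction of the table error pay for its
  contribution \<open>\<lambda>/n\<close> to the estimation error.
\<close>

definition lyap :: "(nat \<Rightarrow> nat list) \<Rightarrow> nat \<Rightarrow> real" where
  "lyap S k = (norm (err S k))\<^sup>2 + 6 / real n * tab_err S k"

text \<open>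
  An upper bound for the level at which the root mean squared estimation error settles. The constant
  comes from \<open>168 \<le> 13\<^sup>2\<close>.
\<close>

definition noise :: real where
  "noise = 13 * sqrt (real n) * Lt * (eta * D) / real b"

lemma lyap_step:
  "measure_pmf.expectation (batch_pmf n b) (\<lambda>B. lyap (S(k := B)) (Suc k)) \<le>
    (1 - lam / 6) * lyap S k + 14 * move / real b"
proof -
  have "measure_pmf.expectation (batch_pmf n b) (\<lambda>B. lyap (S(k := B)) (Suc k)) =
      measure_pmf.expectation (batch_pmf n b) (\<lambda>B. (norm (err (S(k := B)) (Suc k)))\<^sup>2)
      + 6 / real n * measure_pmf.expectation (batch_pmf n b) (\<lambda>B. tab_err (S(k := B)) (Suc k))"
    unfolding lyap_def
    by (subst Bochner_Integration.integral_add)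
       (auto intro!: integrable_measure_pmf_finite[OF finite_set_batch_pmf[OF n]]
          simp del: One_nat_def)
  also have "\<dots> \<le> ((1 - lam) * (norm (err S k))\<^sup>2 + 2 / real b * move + lam / real n * tab_err S k)
      + 6 / real n * ((1 - lam / 3) * tab_err S k + move / lam)"
    by (intro add_mono err_step mult_left_mono tab_err_step) simp
  also have "\<dots> = (1 - lam) * (norm (err S k))\<^sup>2 + (1 - lam / 6) * (6 / real n * tab_err S k)
      + (2 / real b * move + 6 / (real n * lam) * move)"
    using n lam by (simp add: field_simps)
  also have "2 / real b * move + 6 / (real n * lam) * move = 14 * move / real b"
    using n b by (simp add: lam_def field_simps)
  also have "(1 - lam) * (norm (err S k))\<^sup>2 \<le> (1 - lam / 6) * (norm (err S k))\<^sup>2"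
    using lam by (intro mult_right_mono) auto
  finally show ?thesis
    unfolding lyap_def by (simp only: distrib_left)
qed

lemma expectation_lyap_Suc:
  assumes "k < K"
  shows "measure_pmf.expectation (batches_pmf n b K) (\<lambda>S. lyap S (Suc k)) \<le>
    (1 - lam / 6) * measure_pmf.expectation (batches_pmf n b K) (\<lambda>S. lyap S k)
    + 14 * move / real b"
proof -
  note fin = finite_set_batches_pmf[OF n, of b K]
  have "measure_pmf.expectation (batches_pmf n b K) (\<lambda>S. lyap S (Suc k)) =
      measure_pmf.expectation (batches_pmf n b K)
        (\<lambda>S. measure_pmf.expectation (batch_pmf n b) (\<lambda>B. lyap (S(k := B)) (Suc k)))"
    unfolding batches_pmf_def using assms finite_set_batch_pmf[OF n]
    by (intro expectation_Pi_pmf_resample) auto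
  also have "\<dots> \<le> measure_pmf.expectation (batches_pmf n b K)
      (\<lambda>S. (1 - lam / 6) * lyap S k + 14 * move / real b)"
    by (intro expectation_mono_finite fin lyap_step)
  also have "\<dots> = (1 - lam / 6) * measure_pmf.expectation (batches_pmf n b K) (\<lambda>S. lyap S k)
      + 14 * move / real b"
    by (subst Bochner_Integration.integral_add)
       (auto intro!: integrable_measure_pmf_finite[OF fin])
  finally show ?thesis .
qed

lemma lyap_nonneg: "0 \<le> lyap S k"
  by (simp add: lyap_def tab_err_nonneg)

lemma lyap_0: "lyap S 0 = (norm (g0 - mean_grad x0 - r))\<^sup>2
    + 6 / real n * ((1 / real n) * (\<Sum>i=1..n. (norm (df i x0 - y0 i))\<^sup>2))"
  by (simp add: lyap_def err_def tab_err_def it_def est_def tab_def state_def)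

lemma noise_nonneg: "0 \<le> noise"
  using Lt D_nonneg eta by (simp add: noise_def)

lemma noise_sq: "84 * move / (real b * lam) \<le> noise\<^sup>2"
proof -
  have "84 * move / (real b * lam) = 168 * (real n * move / (real b)\<^sup>2)"
    using n b by (simp add: lam_def field_simps power2_eq_square)
  also have "\<dots> \<le> 169 * (real n * move / (real b)\<^sup>2)"
    using move_nonneg by (intro mult_right_mono) auto
  also have "\<dots> = noise\<^sup>2"
    by (simp add: noise_def move_def power_mult_distrib power_divide)
  finally show ?thesis .
qed

lemma expectation_lyap_bound:
  assumes "k \<le> K"
  shows "measure_pmf.expectation (batches_pmf n b K) (\<lambda>S. lyap S k) \<le>
    (1 - lam / 6) ^ k * lyap (\<lambda>_. []) 0 + noise\<^sup>2"
  using assms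
proof (induction k)
  case 0
  show ?case by (simp add: lyap_0)
next
  case (Suc k)
  \<comment> \<open>the fixed point of the recursion \<open>expectation_lyap_Suc\<close>\<close>
  define R where "R = 84 * move / (real b * lam)"
  have R: "14 * move / real b = lam / 6 * R"
    using lam by (simp add: R_def)
  have "measure_pmf.expectation (batches_pmf n b K) (\<lambda>S. lyap S (Suc k)) \<le>
      (1 - lam / 6) * measure_pmf.expectation (batches_pmf n b K) (\<lambda>S. lyap S k) + lam / 6 * R"
    using expectation_lyap_Suc[of k K] Suc.prems unfolding R by simp
  also have "\<dots> \<le> (1 - lam / 6) * ((1 - lam / 6) ^ k * lyap (\<lambda>_. []) 0 + noise\<^sup>2)
      + lam / 6 * noise\<^sup>2"
    using lam Suc noise_sq unfolding R_def by (intro add_mono mult_left_mono) auto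
  also have "\<dots> = (1 - lam / 6) ^ Suc k * lyap (\<lambda>_. []) 0 + noise\<^sup>2"
    by (simp add: algebra_simps)
  finally show ?case .
qed

text \<open>
  Taking the square root before summing over \<open>k\<close> keeps the contribution of the initial error
  geometric, hence summable with a bound independent of the number of iterations.
\<close>

lemma expectation_norm_err:
  assumes "k \<le> K"
  shows "measure_pmf.expectation (batches_pmf n b K) (\<lambda>S. norm (err S k)) \<le>
    (1 - lam / 12) ^ k * sqrt (lyap (\<lambda>_. []) 0) + noise"
proof -
  note fin = finite_set_batches_pmf[OF n, of b K]
  have "(1 - lam / 12)\<^sup>2 = 1 - lam / 6 + (lam / 12)\<^sup>2"
    by (simp add: power2_eq_square algebra_simps)
  then have rate: "1 - lam / 6 \<le> (1 - lam / 12)\<^sup>2"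
    by simp
  have "measure_pmf.expectation (batches_pmf n b K) (\<lambda>S. norm (err S k)) \<le>
      sqrt (measure_pmf.expectation (batches_pmf n b K) (\<lambda>S. (norm (err S k))\<^sup>2))"
    by (rule expectation_le_sqrt_second_moment[OF fin])
  also have "\<dots> \<le> sqrt (measure_pmf.expectation (batches_pmf n b K) (\<lambda>S. lyap S k))"
    using tab_err_nonneg
    by (intro real_sqrt_le_mono expectation_mono_finite fin) (simp add: lyap_def)
  also have "\<dots> \<le> sqrt ((1 - lam / 6) ^ k * lyap (\<lambda>_. []) 0 + noise\<^sup>2)"
    by (intro real_sqrt_le_mono expectation_lyap_bound assms)
  also have "\<dots> \<le> sqrt (((1 - lam / 12)\<^sup>2) ^ k * lyap (\<lambda>_. []) 0 + noise\<^sup>2)"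
    using rate lam lyap_nonneg
    by (intro real_sqrt_le_mono add_right_mono mult_right_mono power_mono) auto
  also have "\<dots> \<le> sqrt (((1 - lam / 12)\<^sup>2) ^ k * lyap (\<lambda>_. []) 0) + sqrt (noise\<^sup>2)"
    using lyap_nonneg by (intro sqrt_add_le_add_sqrt) auto
  also have "\<dots> = (1 - lam / 12) ^ k * sqrt (lyap (\<lambda>_. []) 0) + noise"
    using lam noise_nonneg
    by (simp add: real_sqrt_mult real_sqrt_power)
  finally show ?thesis .
qed

lemma sum_expectation_norm_err:
  "(\<Sum>k<K. measure_pmf.expectation (batches_pmf n b K) (\<lambda>S. norm (err S k))) \<le>
    12 / lam * sqrt (lyap (\<lambda>_. []) 0) + real K * noise"
proof -
  have "(\<Sum>k<K. (1 - lam / 12) ^ k) \<le> 12 / lam"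
  proof -
    have "(\<Sum>k<K. (1 - lam / 12) ^ k) = (1 - (1 - lam / 12) ^ K) / (lam / 12)"
      using lam by (subst sum_gp_strict) auto
    also have "\<dots> \<le> 1 / (lam / 12)"
      using lam by (intro divide_right_mono) auto
    finally show ?thesis by simp
  qed
  then have "(\<Sum>k<K. (1 - lam / 12) ^ k) * sqrt (lyap (\<lambda>_. []) 0) \<le> 12 / lam * sqrt (lyap (\<lambda>_. []) 0)"
    using lyap_nonneg by (intro mult_right_mono) auto
  moreover have "(\<Sum>k<K. measure_pmf.expectation (batches_pmf n b K) (\<lambda>S. norm (err S k))) \<le>
      (\<Sum>k<K. (1 - lam / 12) ^ k * sqrt (lyap (\<lambda>_. []) 0) + noise)"
    by (intro sum_mono expectation_norm_err) auto
  ultimately show ?thesis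
    by (simp add: sum.distrib sum_distrib_right)
qed

section \<open>Descent and the bound on the gap\<close>

lemma mean_grad_directions:
  assumes "x \<in> X" "z \<in> X"
  shows "dF x \<bullet> (z - x) = mean_grad x \<bullet> (z - x)"
proof (rule gradients_agree_on_directions[of F dF X mean_grad, OF _ _ X(1) assms])
  show "is_gradient_on F dF X"
    using smooth_F by (simp add: smooth_on_def)
  have "is_gradient_on F (\<lambda>x. (1 / real n) *\<^sub>R (\<Sum>i=1..n. df i x)) X"
    by (rule is_gradient_on_mean[of X F n f df, OF F])
       (use smooth_f in \<open>simp_all only: smooth_on_def\<close>)
  then show "is_gradient_on F mean_grad X"
    unfolding mean_grad_def[abs_def] .
qed

text \<open>
  The linear minimization step compares with every \<open>z \<in> X\<close>, at the price of the error of the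
  estimator. The part \<open>r\<close> of the error drops out, being orthogonal to \<open>s - z\<close>.
\<close>

lemma descent:
  "eta * fw_gap X dF (it S k) \<le>
    F (it S k) - F (it S (Suc k)) + eta * D * norm (err S k) + L * (eta * D)\<^sup>2"
proof -
  define x where "x = it S k"
  define x' where "x' = it S (Suc k)"
  define s where "s = lmo (map S [0..<k]) (est S k)"
  define Q where "Q = F x - F x' + eta * D * norm (err S k) + L * (eta * D)\<^sup>2"
  have x: "x \<in> X" and x': "x' \<in> X" and s: "s \<in> X"
    and s_min: "\<And>z. z \<in> X \<Longrightarrow> est S k \<bullet> s \<le> est S k \<bullet> z"
    using it_in lmo by (auto simp: x_def x'_def s_def lmo_on_def)
  have x'_eq: "x' - x = eta *\<^sub>R (s - x)"
    by (simp add: x_def x'_def s_def it_Suc)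
  have L: "0 < L"
    using smooth_F by (simp add: smooth_on_def)
  have "F x' \<le> F x + dF x \<bullet> (x' - x) + L * (norm (x' - x))\<^sup>2"
    by (rule smooth_on_upper_bound[OF smooth_F X(1) x x'])
  moreover have "L * (norm (x' - x))\<^sup>2 \<le> L * (eta * D)\<^sup>2"
    using L step_length[of S k] unfolding x_def x'_def
    by (intro mult_left_mono power_mono) auto
  ultimately have up: "F x' \<le> F x + eta * (dF x \<bullet> (s - x)) + L * (eta * D)\<^sup>2"
    unfolding x'_eq by simp
  have point: "dF x \<bullet> (x - z) \<le> Q / eta" if z: "z \<in> X" for z
  proof -
    have "est S k = mean_grad x + err S k + (1 - lam) ^ k *\<^sub>R r"
      by (simp add: err_def x_def)
    then have "mean_grad x \<bullet> (s - z) = est S k \<bullet> (s - z) - err S k \<bullet> (s - z)"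
      using r_orthogonal[OF s z] by (simp add: inner_add_left)
    also have "\<dots> \<le> norm (err S k) * norm (z - s)"
      using s_min[OF z] norm_cauchy_schwarz[of "err S k" "z - s"]
      by (simp add: inner_diff_right)
    also have "\<dots> \<le> norm (err S k) * D"
      using X(2)[OF z s] by (intro mult_left_mono) auto
    finally have "dF x \<bullet> (s - x) \<le> dF x \<bullet> (z - x) + norm (err S k) * D"
      using mean_grad_directions[OF x s] mean_grad_directions[OF x z]
      by (simp add: inner_diff_right)
    then have "eta * (dF x \<bullet> (s - x)) \<le> eta * (dF x \<bullet> (z - x) + norm (err S k) * D)"
      using eta by (intro mult_left_mono) auto
    with up have "(dF x \<bullet> (x - z)) * eta \<le> Q"
      by (simp add: Q_def inner_diff_right algebra_simps)
    then show ?thesis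
      using eta by (simp add: pos_le_divide_eq)
  qed
  have "fw_gap X dF x \<le> Q / eta"
    unfolding fw_gap_def using x point by (intro cSUP_least) auto
  then show ?thesis
    using eta by (simp add: Q_def x_def x'_def pos_le_divide_eq mult.commute)
qed

lemma min_gap_bound:
  assumes K: "1 \<le> K" and lower: "\<And>x. x \<in> X \<Longrightarrow> Fmin \<le> F x"
  shows "real K * eta * (MIN k\<in>{0..K-1}. fw_gap X dF (it S k)) \<le>
    F x0 - Fmin + eta * D * (\<Sum>k<K. norm (err S k)) + real K * (L * (eta * D)\<^sup>2)"
proof -
  define m where "m = (MIN k\<in>{0..K-1}. fw_gap X dF (it S k))"
  have "real K * eta * m = (\<Sum>k<K. eta * m)"
    by simp
  also have "\<dots> \<le> (\<Sum>k<K. eta * fw_gap X dF (it S k))"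
    using eta unfolding m_def by (intro sum_mono mult_left_mono Min_le) auto
  also have "\<dots> \<le> (\<Sum>k<K. F (it S k) - F (it S (Suc k)) + eta * D * norm (err S k) + L * (eta * D)\<^sup>2)"
    by (rule sum_mono) (rule descent)
  also have "\<dots> = F (it S 0) - F (it S K) + eta * D * (\<Sum>k<K. norm (err S k))
      + real K * (L * (eta * D)\<^sup>2)"
    by (simp add: sum.distrib sum_lessThan_telescope'[of "\<lambda>k. F (it S k)"] sum_distrib_left)
  also have "\<dots> \<le> F x0 - Fmin + eta * D * (\<Sum>k<K. norm (err S k)) + real K * (L * (eta * D)\<^sup>2)"
    using lower[OF it_in, of S K] by (simp add: it_def state_def)
  finally show ?thesis
    unfolding m_def .
qed

text \<open>
  The last summand, due to the initialization, does not grow with \<open>K\<close>. It vanishes if the table is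
  exact and the initial estimator is the mean gradient up to \<open>r\<close>.
\<close>

theorem expected_min_gap:
  assumes K: "1 \<le> K" and lower: "\<And>x. x \<in> X \<Longrightarrow> Fmin \<le> F x"
  shows "real K * eta * measure_pmf.expectation (batches_pmf n b K)
      (\<lambda>S. MIN k\<in>{0..K-1}. fw_gap X dF
        (fst (saga_sarah_fw n b (\<lambda>_. eta) (real b / (2 * real n)) df lmo x0 g0 y0 S k))) \<le>
    F x0 - Fmin + real K * (L * (eta * D)\<^sup>2)
    + real K * (13 * sqrt (real n) * Lt * (eta * D)\<^sup>2 / real b)
    + eta * D * (24 * real n / real b *
        sqrt ((norm (g0 - (1 / real n) *\<^sub>R (\<Sum>i=1..n. df i x0) - r))\<^sup>2
          + 6 / real n * ((1 / real n) * (\<Sum>i=1..n. (norm (df i x0 - y0 i))\<^sup>2))))"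
proof -
  note int = integrable_measure_pmf_finite[OF finite_set_batches_pmf[OF n, of b K]]
  have "real K * eta * measure_pmf.expectation (batches_pmf n b K)
      (\<lambda>S. MIN k\<in>{0..K-1}. fw_gap X dF (it S k)) =
    measure_pmf.expectation (batches_pmf n b K)
      (\<lambda>S. real K * eta * (MIN k\<in>{0..K-1}. fw_gap X dF (it S k)))"
    by simp
  also have "\<dots> \<le> measure_pmf.expectation (batches_pmf n b K)
      (\<lambda>S. F x0 - Fmin + eta * D * (\<Sum>k<K. norm (err S k)) + real K * (L * (eta * D)\<^sup>2))"
    by (intro expectation_mono_finite finite_set_batches_pmf n min_gap_bound K lower)
  also have "\<dots> = F x0 - Fmin + eta * D *
        (\<Sum>k<K. measure_pmf.expectation (batches_pmf n b K) (\<lambda>S. norm (err S k)))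
      + real K * (L * (eta * D)\<^sup>2)"
    by (simp add: int del: of_nat_mult)
  also have "\<dots> \<le> F x0 - Fmin + eta * D * (12 / lam * sqrt (lyap (\<lambda>_. []) 0) + real K * noise)
      + real K * (L * (eta * D)\<^sup>2)"
    using eta D_nonneg
    by (intro add_mono order_refl mult_left_mono sum_expectation_norm_err) auto
  also have "\<dots> = F x0 - Fmin + real K * (L * (eta * D)\<^sup>2)
      + real K * (13 * sqrt (real n) * Lt * (eta * D)\<^sup>2 / real b)
      + eta * D * (24 * real n / real b * sqrt (lyap (\<lambda>_. []) 0))"
    using n b by (simp add: noise_def lam_def power2_eq_square field_simps)
  finally show ?thesis
    unfolding it_def state_def lyap_0 mean_grad_def lam_def .
qed

end

section \<open>The convergence rate\<close>

theorem theorem4p7: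
  fixes X :: "'a::euclidean_space set"
    and f :: "nat \<Rightarrow> 'a \<Rightarrow> real" and df :: "nat \<Rightarrow> 'a \<Rightarrow> 'a"
    and F :: "'a \<Rightarrow> real" and dF :: "'a \<Rightarrow> 'a"
    and n b :: nat and D L Lt :: real and Ls :: "nat \<Rightarrow> real"
    and lmo :: "nat list list \<Rightarrow> 'a \<Rightarrow> 'a"
    and x0 g0 xstar :: 'a and y0 :: "nat \<Rightarrow> 'a"
  assumes n: "1 \<le> n" and b: "1 \<le> b" "b \<le> 2 * n"
    and X: "convex X" "compact X" "\<And>x y. x \<in> X \<Longrightarrow> y \<in> X \<Longrightarrow> norm (x - y) \<le> D"
    and F: "\<And>x. x \<in> X \<Longrightarrow> F x = (1 / real n) * (\<Sum>i=1..n. f i x)"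
    and smooth_F: "smooth_on L F dF X"
    and smooth_f: "\<And>i. i \<in> {1..n} \<Longrightarrow> smooth_on (Ls i) (f i) (df i) X"
    and Lt: "0 \<le> Lt" "Lt\<^sup>2 = (1 / real n) * (\<Sum>i=1..n. (Ls i)\<^sup>2)"
    and xstar: "xstar \<in> X" "\<And>x. x \<in> X \<Longrightarrow> F xstar \<le> F x"
    and lmo: "lmo_on X lmo"
    and x0: "x0 \<in> X"
    and g0: "g0 = dF x0 \<or> (\<exists>i0\<in>{1..n}. g0 = df i0 x0)"
    and y0: "\<And>i. i \<in> {1..n} \<Longrightarrow> y0 i = df i x0 \<or> y0 i = 0"
  shows "\<exists>K0\<ge>1.
    (g0 = dF x0 \<and> (\<forall>i\<in>{1..n}. y0 i = df i x0) \<longrightarrow> K0 = 1) \<and>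
    (\<forall>K\<ge>K0.
      measure_pmf.expectation (batches_pmf n b K)
        (\<lambda>S. MIN k\<in>{0..K-1}.
          fw_gap X dF (fst (saga_sarah_fw n b (\<lambda>_. 1 / sqrt (real K)) (real b / (2 * real n))
                              df lmo x0 g0 y0 S k)))
      \<le> 100 * ((F x0 - F xstar) / sqrt (real K)
               + L * D\<^sup>2 / sqrt (real K) * (1 + Lt * sqrt (real n) / (L * real b))))"
proof -
  define G where "G x = (1 / real n) *\<^sub>R (\<Sum>i=1..n. df i x)" for x
  \<comment> \<open>for \<open>g0 = dF x0\<close> the initial error is orthogonal to the directions of \<open>X\<close>, hence harmless\<close>
  define r where "r = (if g0 = dF x0 then g0 - G x0 else 0)"
  define v0 where "v0 = (norm (g0 - G x0 - r))\<^sup>2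
      + 6 / real n * ((1 / real n) * (\<Sum>i=1..n. (norm (df i x0 - y0 i))\<^sup>2))"
  \<comment> \<open>the contribution of the initialization to the bound is \<open>D * c / K\<close>\<close>
  define c where "c = 24 * real n / real b * sqrt v0"
  define W where "W = D * Lt * sqrt (real n) / real b"
  \<comment> \<open>chosen such that \<open>c / sqrt K \<le> W\<close> for \<open>K \<ge> K0\<close>; if \<open>W = 0\<close> then \<open>D = 0\<close> and nothing is needed\<close>
  define K0 where "K0 = max 1 (nat \<lceil>(c / W)\<^sup>2\<rceil>)"
  have D: "0 \<le> D"
    using X(3)[OF x0 x0] by simp
  have L: "0 < L"
    using smooth_F by (simp add: smooth_on_def)
  have "0 < Ls i" if "i \<in> {1..n}" for i
    using smooth_f[OF that] by (simp add: smooth_on_def)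
  then have "0 < (\<Sum>i=1..n. (Ls i)\<^sup>2)"
    using n by (intro sum_pos zero_less_power) auto
  then have "0 < Lt\<^sup>2"
    using n by (simp add: Lt(2))
  then have Lt_pos: "0 < Lt"
    using Lt(1) by (cases "Lt = 0") auto
  have v0: "0 \<le> v0"
    by (simp add: v0_def sum_nonneg)
  have c: "0 \<le> c"
    using v0 by (simp add: c_def)
  have r: "r \<bullet> (x - y) = 0" if "x \<in> X" "y \<in> X" for x y
  proof -
    have "is_gradient_on F G X"
      unfolding G_def[abs_def]
      by (rule is_gradient_on_mean[of X F n f df, OF F])
         (use smooth_f in \<open>simp_all only: smooth_on_def\<close>)
    moreover have "is_gradient_on F dF X"
      using smooth_F by (simp add: smooth_on_def)
    ultimately have "dF x0 \<bullet> (z - x0) = G x0 \<bullet> (z - x0)" if "z \<in> X" for z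
      using X(1) x0 that by (intro gradients_agree_on_directions) auto
    from this[OF that(1)] this[OF that(2)] show ?thesis
      by (auto simp: r_def inner_diff_left inner_diff_right)
  qed
  have K0_exact: "K0 = 1" if "g0 = dF x0 \<and> (\<forall>i\<in>{1..n}. y0 i = df i x0)"
  proof -
    have "v0 = 0"
      using that by (simp add: v0_def r_def)
    then show ?thesis
      by (simp add: K0_def c_def)
  qed
  have bound: "measure_pmf.expectation (batches_pmf n b K)
        (\<lambda>S. MIN k\<in>{0..K-1}.
          fw_gap X dF (fst (saga_sarah_fw n b (\<lambda>_. 1 / sqrt (real K)) (real b / (2 * real n))
                              df lmo x0 g0 y0 S k)))
      \<le> 100 * ((F x0 - F xstar) / sqrt (real K)
               + L * D\<^sup>2 / sqrt (real K) * (1 + Lt * sqrt (real n) / (L * real b)))"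
    (is "?E \<le> _") if K: "K0 \<le> K" for K
  proof -
    define s where "s = sqrt (real K)"
    have K1: "1 \<le> K"
      using K by (simp add: K0_def)
    have s: "1 \<le> s" "s\<^sup>2 = real K"
      using K1 by (auto simp: s_def)
    interpret saga_sarah X f df F dF n b D L Lt Ls lmo x0 g0 y0 "1 / s" r
      by unfold_locales (use n b X F smooth_F smooth_f Lt lmo x0 s r in auto)
    have "real K * (1 / s) * ?E \<le> F x0 - F xstar + real K * (L * (1 / s * D)\<^sup>2)
        + real K * (13 * sqrt (real n) * Lt * (1 / s * D)\<^sup>2 / real b) + 1 / s * D * c"
      using expected_min_gap[OF K1 xstar(2)] unfolding s_def c_def v0_def G_def .
    also have "real K * (1 / s) = s"
      using s by (simp add: power2_eq_square flip: s(2))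
    also have "real K * (L * (1 / s * D)\<^sup>2) = L * D\<^sup>2"
      using s by (simp add: power_divide flip: s(2))
    also have "real K * (13 * sqrt (real n) * Lt * (1 / s * D)\<^sup>2 / real b) = 13 * (D * W)"
      using s by (simp add: W_def power_divide power2_eq_square[of D] flip: s(2))
    also have "1 / s * D * c \<le> D * W"
    proof (cases "D = 0")
      case False
      then have W: "0 < W"
        using D Lt_pos n b by (simp add: W_def)
      have "(c / W)\<^sup>2 \<le> real K"
        using K by (simp add: K0_def)
      then have "c / W \<le> s"
        unfolding s_def by (rule real_le_rsqrt)
      then have "c \<le> s * W"
        using W by (simp add: pos_divide_le_eq)
      then have "D * c \<le> D * (s * W)"
        using D by (rule mult_left_mono)
      then show ?thesis
        using s by (simp add: field_simps)
    qed simp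
    finally have "s * ?E \<le> (F x0 - F xstar) + L * D\<^sup>2 + 14 * (D * W)"
      by simp
    also have "\<dots> \<le> 100 * ((F x0 - F xstar) + L * D\<^sup>2 + D * W)"
    proof -
      have "0 \<le> F x0 - F xstar" "0 \<le> L * D\<^sup>2" "0 \<le> D * W"
        using xstar(2)[OF x0] L D Lt_pos by (simp_all add: W_def)
      then show ?thesis by simp
    qed
    also have "D * W = L * D\<^sup>2 * (Lt * sqrt (real n) / (L * real b))"
      using L by (simp add: W_def power2_eq_square)
    finally have "?E \<le> 100 * ((F x0 - F xstar) + L * D\<^sup>2
        + L * D\<^sup>2 * (Lt * sqrt (real n) / (L * real b))) / s"
      using s by (simp add: pos_le_divide_eq mult.commute)
    also have "\<dots> = 100 * ((F x0 - F xstar) / s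
        + L * D\<^sup>2 / s * (1 + Lt * sqrt (real n) / (L * real b)))"
      by (simp add: add_divide_distrib distrib_left)
    finally show ?thesis
      unfolding s_def .
  qed
  show ?thesis
    using K0_exact bound by (intro exI[of _ K0]) (simp add: K0_def)
qed

end
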